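(* Let $(K,|\cdot|)$ be a non-Archimedean discretely valued field with finite residue field (e.g., $(\mathbb Q,|\cdot|_p)$ or $(\mathbb Q_p,|\cdot|_p)$ for a prime $p$), let $D$ be its ring of integers, and let $n\ge2$. Then any bounded subset of $K^n$ with nonempty interior is $\mathrm{SA}(n,D,K)$-paradoxical.
   Context: A non-Archimedean valuation on a field $K$ is a function $|\cdot|:K\to[0,\infty)$ with $|x|=0\iff x=0$, $|xy|=|x||y|$, $|x+y|\le\max\{|x|,|y|\}$. With $|K^*|=\{|x|:x\in K,x\ne0\}$, the valuation is discrete if $|K^*|\cap(0,1)$ is nonempty and has a maximum (so in particular the valuation is nontrivial). $D=\{x\in K:|x|\le1\}$ is the ring of integers, $\mathfrak m=\{x:|x|<1\}$, and the residue field is $D/\mathfrak m$. $K^n$ carries the norm $\|x\|=\max_i|x_i|$ and its induced metric and topology. $\mathrm{SA}(n,D,K)$ is the group of affine maps $K^n\to K^n$, $x\mapsto L(x)+\tau$, with $L\in\mathrm{SL}(n,D)$ and $\tau\in K^n$. For a group $G$ acting on a set $X$, a nonempty subset $E\subseteq X$ is $G$-paradoxical if for some positive integers $m,l$ there exist pairwise disjoint subsets $A_1,\dots,A_m,B_1,\dots,B_l$ of $E$ and $g_1,\dots,g_m,h_1,\dots,h_l\in G$ such that $E=\bigcup_{i=1}^m g_i(A_i)=\bigcup_{j=1}^l h_j(B_j)$. The axiom of choice is assumed. *)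

theory Defs
  imports
    "HOL-Analysis.Analysis"
    "HOL-Algebra.QuotRing"
    "HOL-Algebra.Group_Action"
begin

locale nonarch_valuation =
  fixes v :: "'k::field \<Rightarrow> real"
  assumes nonneg: "0 \<le> v x"
    and eq_0_iff: "v x = 0 \<longleftrightarrow> x = 0"
    and mult: "v (x * y) = v x * v y"
    and ultra: "v (x + y) \<le> max (v x) (v y)"

definition value_group :: "('k::field \<Rightarrow> real) \<Rightarrow> real set" where
  "value_group v = v ` (UNIV - {0})"

locale discrete_valuation = nonarch_valuation v for v :: "'k::field \<Rightarrow> real" +
  assumes discrete: "\<exists>r \<in> value_group v \<inter> {0<..<1}. \<forall>s \<in> value_group v \<inter> {0<..<1}. s \<le> r"

definition integers_ring :: "('k::field \<Rightarrow> real) \<Rightarrow> 'k ring" where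
  "integers_ring v =
    \<lparr>carrier = {x. v x \<le> 1}, mult = (*), one = 1, zero = 0, add = (+)\<rparr>"

definition max_ideal :: "('k::field \<Rightarrow> real) \<Rightarrow> 'k set" where
  "max_ideal v = {x. v x < 1}"

definition residue_field :: "('k::field \<Rightarrow> real) \<Rightarrow> 'k set ring" where
  "residue_field v = integers_ring v Quot max_ideal v"

definition max_norm :: "('k::field \<Rightarrow> real) \<Rightarrow> 'k ^ 'n \<Rightarrow> real" where
  "max_norm v x = Max (range (\<lambda>i. v (x $ i)))"

definition max_dist :: "('k::field \<Rightarrow> real) \<Rightarrow> 'k ^ 'n \<Rightarrow> 'k ^ 'n \<Rightarrow> real" where
  "max_dist v x y = max_norm v (x - y)"

definition SL :: "('k::field \<Rightarrow> real) \<Rightarrow> ('k ^ 'n ^ 'n) set" where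
  "SL v = {A. (\<forall>i j. A $ i $ j \<in> carrier (integers_ring v)) \<and> det A = 1}"

definition SA :: "('k::field \<Rightarrow> real) \<Rightarrow> ('k ^ 'n \<Rightarrow> 'k ^ 'n) monoid" where
  "SA v = \<lparr>carrier = {\<lambda>x. A *v x + t |A t. A \<in> SL v}, mult = (\<circ>), one = id\<rparr>"

text \<open>The pieces are indexed families, so disjointness concerns distinct indices and a
  piece may be empty; \<open>\<phi>\<close> is the action of \<open>G\<close> on \<open>X\<close>.\<close>

definition paradoxical ::
    "('g, 'b) monoid_scheme \<Rightarrow> 'a set \<Rightarrow> ('g \<Rightarrow> 'a \<Rightarrow> 'a) \<Rightarrow> 'a set \<Rightarrow> bool" where
  "paradoxical G X \<phi> E \<longleftrightarrow>
    E \<subseteq> X \<and> E \<noteq> {} \<and>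
    (\<exists>(m::nat) (l::nat) A B g h. m > 0 \<and> l > 0 \<and>
      (\<forall>i<m. A i \<subseteq> E) \<and> (\<forall>j<l. B j \<subseteq> E) \<and>
      disjoint_family_on A {..<m} \<and> disjoint_family_on B {..<l} \<and>
      (\<forall>i<m. \<forall>j<l. A i \<inter> B j = {}) \<and>
      (\<forall>i<m. g i \<in> carrier G) \<and> (\<forall>j<l. h j \<in> carrier G) \<and>
      E = (\<Union>i<m. \<phi> (g i) ` A i) \<and> E = (\<Union>j<l. \<phi> (h j) ` B j))"

context nonarch_valuation
begin

lemma v_0 [simp]: "v 0 = 0"
  by (simp add: eq_0_iff)

lemma v_1 [simp]: "v 1 = 1"
proof -
  have "v 1 * v 1 = v 1 * 1" using mult[of 1 1] by simp
  thus ?thesis using eq_0_iff[of 1] by (metis mult_cancel_left zero_neq_one)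
qed

lemma v_uminus [simp]: "v (- x) = v x"
proof -
  have "v (-1) * v (-1) = 1" using mult[of "-1" "-1"] by simp
  hence "v (-1) = 1" using nonneg[of "-1"]
    by (metis abs_of_nonneg abs_square_eq_1 power2_eq_square)
  thus ?thesis using mult[of "-1" x] by simp
qed

lemma v_minus_commute: "v (x - y) = v (y - x)"
  using v_uminus[of "x - y"] by simp

lemma v_add_le: "v x \<le> c \<Longrightarrow> v y \<le> c \<Longrightarrow> v (x + y) \<le> c"
  using ultra[of x y] by linarith

lemma v_add_less: "v x < c \<Longrightarrow> v y < c \<Longrightarrow> v (x + y) < c"
  using ultra[of x y] by linarith

lemma v_mult_le_1: "v x \<le> 1 \<Longrightarrow> v y \<le> 1 \<Longrightarrow> v (x * y) \<le> 1"
  by (simp add: mult mult_le_one nonneg)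

lemma v_sum_le_1: "(\<And>i. i \<in> I \<Longrightarrow> v (f i) \<le> 1) \<Longrightarrow> v (sum f I) \<le> 1"
  by (induction I rule: infinite_finite_induct) (auto intro: v_add_le)

lemma v_prod_le_1: "(\<And>i. i \<in> I \<Longrightarrow> v (f i) \<le> 1) \<Longrightarrow> v (prod f I) \<le> 1"
  by (induction I rule: infinite_finite_induct) (auto intro: v_mult_le_1)

lemma v_det_le_1:
  fixes A :: "'k ^ 'n ^ 'n"
  assumes "\<And>i j. v (A $ i $ j) \<le> 1"
  shows "v (det A) \<le> 1"
proof -
  have "v (of_int (sign p)) = 1" for p :: "'n \<Rightarrow> 'n"
    by (simp add: sign_def)
  thus ?thesis
    unfolding det_def by (intro v_sum_le_1 v_mult_le_1 v_prod_le_1 assms) auto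
qed

lemma integers_ring_cring: "cring (integers_ring v)"
proof (rule cringI)
  show "abelian_group (integers_ring v)"
  proof (rule abelian_groupI)
    fix x assume "x \<in> carrier (integers_ring v)"
    thus "\<exists>y\<in>carrier (integers_ring v). y \<oplus>\<^bsub>integers_ring v\<^esub> x = \<zero>\<^bsub>integers_ring v\<^esub>"
      by (intro bexI[of _ "- x"]) (auto simp: integers_ring_def)
  qed (auto simp: integers_ring_def intro: v_add_le)
  show "comm_monoid (integers_ring v)"
    by (rule comm_monoidI) (auto simp: integers_ring_def intro: v_mult_le_1)
qed (auto simp: integers_ring_def algebra_simps)

lemma a_inv_integers_ring:
  assumes "v x \<le> 1"
  shows "\<ominus>\<^bsub>integers_ring v\<^esub> x = - x"
proof -
  interpret cring "integers_ring v" by (rule integers_ring_cring)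
  show ?thesis
    by (rule minus_equality) (use assms in \<open>auto simp: integers_ring_def\<close>)
qed

lemma max_ideal_ideal: "ideal (max_ideal v) (integers_ring v)"
proof -
  interpret cring "integers_ring v" by (rule integers_ring_cring)
  have *: "v (x * y) < 1" if "v x < 1" "v y \<le> 1" for x y
    using that mult_right_le_one_le[of "v x" "v y"] nonneg[of x] nonneg[of y] mult[of x y]
    by linarith
  show ?thesis
  proof (rule idealI[OF ring_axioms])
    have "\<ominus>\<^bsub>integers_ring v\<^esub> a \<in> max_ideal v" if "a \<in> max_ideal v" for a
      using a_inv_integers_ring[of a] that by (simp add: max_ideal_def)
    moreover have "max_ideal v \<noteq> {}"
      unfolding max_ideal_def by (auto intro: exI[of _ 0])
    moreover have "max_ideal v \<subseteq> carrier (integers_ring v)"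
      by (auto simp: max_ideal_def integers_ring_def)
    moreover have "a \<oplus>\<^bsub>integers_ring v\<^esub> b \<in> max_ideal v"
      if "a \<in> max_ideal v" "b \<in> max_ideal v" for a b
      using that v_add_less by (simp add: max_ideal_def integers_ring_def)
    ultimately show "subgroup (max_ideal v) (add_monoid (integers_ring v))"
      by (intro add.subgroupI) simp_all
  next
    fix a x assume "a \<in> max_ideal v" "x \<in> carrier (integers_ring v)"
    hence "v (a * x) < 1"
      using * by (simp add: max_ideal_def integers_ring_def)
    thus "x \<otimes>\<^bsub>integers_ring v\<^esub> a \<in> max_ideal v"
      and "a \<otimes>\<^bsub>integers_ring v\<^esub> x \<in> max_ideal v"
      by (simp_all add: max_ideal_def integers_ring_def mult.commute)
  qed
qed

lemma max_norm_le_iff: "max_norm v x \<le> c \<longleftrightarrow> (\<forall>i. v (x $ i) \<le> c)"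
  unfolding max_norm_def by (subst Max_le_iff) auto

lemma v_le_max_norm: "v (x $ i) \<le> max_norm v x"
  using max_norm_le_iff by blast

lemma Metric_space_max_dist: "Metric_space UNIV (max_dist v :: 'k ^ 'n \<Rightarrow> _)"
proof
  fix x y z :: "'k ^ 'n"
  have nn: "0 \<le> max_norm v w" for w :: "'k ^ 'n"
    using order_trans[OF nonneg v_le_max_norm] by blast
  show "0 \<le> max_dist v x y"
    by (simp add: max_dist_def nn)
  show "max_dist v x y = max_dist v y x"
    using v_minus_commute by (simp add: max_dist_def max_norm_def)
  show "(max_dist v x y = 0) = (x = y)"
  proof -
    have "max_dist v x y = 0 \<longleftrightarrow> max_dist v x y \<le> 0"
      using nn[of "x - y"] by (auto simp: max_dist_def)
    also have "\<dots> \<longleftrightarrow> (\<forall>i. v (x $ i - y $ i) = 0)"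
    proof -
      have "v w \<le> 0 \<longleftrightarrow> v w = 0" for w
        using nonneg[of w] by linarith
      thus ?thesis by (simp add: max_dist_def max_norm_le_iff)
    qed
    finally show ?thesis
      by (simp add: eq_0_iff vec_eq_iff)
  qed
  have "v (x $ i - z $ i) \<le> max_norm v (x - y) + max_norm v (y - z)" for i
    using ultra[of "x $ i - y $ i" "y $ i - z $ i"] v_le_max_norm[of "x - y" i]
      v_le_max_norm[of "y - z" i] nn[of "x - y"] nn[of "y - z"] by simp
  thus "max_dist v x z \<le> max_dist v x y + max_dist v y z"
    by (simp add: max_dist_def max_norm_le_iff)
qed

lemma SL_mult:
  assumes "A \<in> SL v" "B \<in> SL v"
  shows "A ** B \<in> SL v"
proof -
  have "v ((A ** B) $ i $ j) \<le> 1" for i j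
    using assms by (auto simp: SL_def integers_ring_def matrix_matrix_mult_def
        intro!: v_sum_le_1 v_mult_le_1)
  thus ?thesis
    using assms by (simp add: SL_def integers_ring_def det_mul)
qed

lemma SL_inverse:
  fixes A :: "'k ^ 'n ^ 'n"
  assumes "A \<in> SL v"
  obtains B where "B \<in> SL v" "A ** B = mat 1" "B ** A = mat 1"
proof -
  have d: "det A = 1" and e: "\<And>i j. v (A $ i $ j) \<le> 1"
    using assms by (auto simp: SL_def integers_ring_def)
  obtain B where B: "A ** B = mat 1" "B ** A = mat 1"
    using d invertible_det_nz[of A] unfolding invertible_def by auto
  have dB: "det B = 1"
    using det_mul[of A B] d B by simp
  have "v (B $ k $ j) \<le> 1" for k j
  proof -
    have "A *v (B *v axis j 1) = axis j 1"
      by (simp add: matrix_vector_mul_assoc B)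
    hence "B *v axis j 1 = (\<chi> k. det (\<chi> i l. if l = k then axis j 1 $ i else A $ i $ l) / det A)"
      by (rule iffD1[OF cramer, rotated]) (simp add: d)
    moreover have "(B *v axis j 1) $ k = B $ k $ j"
      by (simp add: matrix_vector_mul_component inner_axis matrix_vector_mult_def axis_def
          if_distrib cong: if_cong)
    ultimately have "B $ k $ j = det (\<chi> i l. if l = k then axis j 1 $ i else A $ i $ l)"
      using d by simp
    moreover have "v (det (\<chi> i l. if l = k then axis j 1 $ i else A $ i $ l)) \<le> 1"
      by (rule v_det_le_1) (auto simp: axis_def e)
    ultimately show ?thesis by simp
  qed
  thus thesis
    using that B dB by (auto simp: SL_def integers_ring_def)
qed

lemma SA_group: "group (SA v :: ('k ^ 'n \<Rightarrow> 'k ^ 'n) monoid)"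
proof (rule groupI)
  fix f g :: "'k ^ 'n \<Rightarrow> 'k ^ 'n"
  assume "f \<in> carrier (SA v)" "g \<in> carrier (SA v)"
  then obtain A s B t where "A \<in> SL v" "B \<in> SL v"
    and f: "f = (\<lambda>x. A *v x + s)" and g: "g = (\<lambda>x. B *v x + t)"
    by (auto simp: SA_def)
  moreover have "f \<circ> g = (\<lambda>x. (A ** B) *v x + (A *v t + s))"
    unfolding f g by (auto simp: matrix_vector_mul_assoc matrix_vector_right_distrib add.assoc)
  ultimately show "f \<otimes>\<^bsub>SA v\<^esub> g \<in> carrier (SA v)"
    unfolding SA_def using SL_mult by fastforce
next
  have "mat 1 \<in> (SL v :: ('k ^ 'n ^ 'n) set)"
    by (auto simp: SL_def integers_ring_def mat_def)
       (metis det_I mat_def)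
  moreover have "id = (\<lambda>x :: 'k ^ 'n. mat 1 *v x + 0)"
    by auto
  ultimately show "\<one>\<^bsub>SA v\<^esub> \<in> carrier (SA v :: ('k ^ 'n \<Rightarrow> _) monoid)"
    unfolding SA_def monoid.simps partial_object.simps by blast
next
  fix f assume "f \<in> carrier (SA v :: ('k ^ 'n \<Rightarrow> _) monoid)"
  then obtain A s where A: "A \<in> SL v" and f: "f = (\<lambda>x. A *v x + s)"
    by (auto simp: SA_def)
  obtain B where B: "B \<in> SL v" "B ** A = mat 1"
    using SL_inverse[OF A] by metis
  define g where "g = (\<lambda>x. B *v x + - (B *v s))"
  have "g \<circ> f = id"
    by (auto simp: f g_def matrix_vector_mul_assoc matrix_vector_right_distrib B)
  moreover have "g \<in> carrier (SA v)"
    using B(1) unfolding SA_def g_def monoid.simps partial_object.simps by blast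
  ultimately show "\<exists>g\<in>carrier (SA v). g \<otimes>\<^bsub>SA v\<^esub> f = \<one>\<^bsub>SA v\<^esub>"
    by (auto simp: SA_def)
qed (auto simp: SA_def)

lemma SA_group_action:
  "group_action (SA v :: ('k ^ 'n \<Rightarrow> 'k ^ 'n) monoid) UNIV (\<lambda>f. f)"
proof -
  interpret group "SA v :: ('k ^ 'n \<Rightarrow> 'k ^ 'n) monoid" by (rule SA_group)
  have bij: "bij f" if f: "f \<in> carrier (SA v)" for f :: "'k ^ 'n \<Rightarrow> 'k ^ 'n"
  proof -
    obtain g where "g \<circ> f = id" "f \<circ> g = id"
      using r_inv[OF f] l_inv[OF f] by (auto simp: SA_def)
    thus ?thesis using o_bij by blast
  qed
  show ?thesis
    unfolding group_action_def group_hom_def group_hom_axioms_def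
  proof (intro conjI is_group group_BijGroup homI)
    fix f g :: "'k ^ 'n \<Rightarrow> 'k ^ 'n"
    assume f: "f \<in> carrier (SA v)" and g: "g \<in> carrier (SA v)"
    show "f \<in> carrier (BijGroup UNIV)"
      using bij[OF f] by (simp add: BijGroup_def Bij_def)
    have "f \<otimes>\<^bsub>BijGroup UNIV\<^esub> g = f \<circ> g"
      using bij[OF f] bij[OF g] by (simp add: BijGroup_def Bij_def compose_def fun_eq_iff)
    thus "f \<otimes>\<^bsub>SA v\<^esub> g = f \<otimes>\<^bsub>BijGroup UNIV\<^esub> g"
      by (simp add: SA_def)
  qed
qed

end

end

(* Let R be a subring of D carrying a notion of size, such as the ring of integers in
   characteristic 0 or F_p[t] with 0 < |t| < 1 in characteristic p. The fractions a/b with a smaller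
   than b have infinitely many pairwise disjoint translates by elements of R, while finitely many of
   their images under SL_2(R) cover the projective line over the fraction field of R. A nonzero
   vector of K^2 that does not span a line rational over R has trivial stabiliser in SL_2(R), so the
   axiom of choice gives an SL_2(R)-equivariant map from the nonzero vectors to the nonzero rational
   ones. Pulling back along it yields W in K^2 - {0} with infinitely many disjoint images under
   shears and finitely many SL_2(R)-images covering K^2 - {0}. Since SL(n, D) preserves the norm,
   restricting the first two coordinates to W inside a small ball gives a subset of K^n with
   infinitely many disjoint images inside E, finitely many images of which cover E. *)

theory Submission
  imports Defs "HOL-Computational_Algebra.Polynomial"
begin

section \<open>Paradoxical decompositions from packing and covering\<close>

text \<open>From the copy \<open>t (s + k)\<close> of \<open>B\<close>, keep the points whose
  originals in \<open>B\<close> are carried into \<open>P\<close> by \<open>g k\<close>; the inverse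
  of \<open>t (s + k)\<close> followed by \<open>g k\<close> moves this piece onto the part of the
  \<open>k\<close>-th covering image inside \<open>P\<close>. The copies are disjoint even where the
  covering images overlap, so 2m copies rebuild \<open>P\<close> twice. Here \<open>E\<close> is the
  whole space of the action.\<close>

lemma (in group_action) paradoxical_if_covered_by_packable:
  fixes t :: "nat \<Rightarrow> 'a" and g :: "nat \<Rightarrow> 'a"
  assumes P: "P \<subseteq> E" "P \<noteq> {}" and B: "B \<subseteq> E"
    and t: "\<And>k. t k \<in> carrier G" "\<And>k. \<phi> (t k) ` B \<subseteq> P"
      "disjoint_family (\<lambda>k. \<phi> (t k) ` B)"
    and g: "\<And>k. k < m \<Longrightarrow> g k \<in> carrier G" and cov: "P \<subseteq> (\<Union>k<m. \<phi> (g k) ` B)"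
  shows "paradoxical G E \<phi> P"
proof -
  \<comment> \<open>The offset \<open>s\<close> selects a block of \<open>m\<close> consecutive
    copies; \<open>s = 0\<close> and \<open>s = m\<close> yield the two halves of the
    decomposition.\<close>
  define A where "A s k = \<phi> (t (s + k)) ` {x \<in> B. \<phi> (g k) x \<in> P}" for s k
  define h where "h s k = g k \<otimes>\<^bsub>G\<^esub> inv\<^bsub>G\<^esub> t (s + k)" for s k
  interpret G: group G
    using group_hom group_hom.axioms(1) by blast
  have h_A: "\<phi> (h s k) ` A s k = {x \<in> \<phi> (g k) ` B. x \<in> P}" if "k < m" for s k
  proof -
    have "\<phi> (h s k) (\<phi> (t (s + k)) x) = \<phi> (g k) x" if "x \<in> B" for x
    proof -
      have "x \<in> E" using that B by blast
      moreover have "\<phi> (t (s + k)) x \<in> E"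
        using element_image[OF t(1) \<open>x \<in> E\<close>] by blast
      ultimately show ?thesis
        using orbit_sym_aux[OF t(1)[of "s + k"]] g[OF \<open>k < m\<close>] t(1)[of "s + k"]
        by (simp add: h_def composition_rule)
    qed
    thus ?thesis by (force simp: A_def image_iff)
  qed
  have cover: "P = (\<Union>k<m. \<phi> (h s k) ` A s k)" for s
  proof -
    have "(\<Union>k<m. \<phi> (h s k) ` A s k) = (\<Union>k<m. {x \<in> \<phi> (g k) ` B. x \<in> P})"
      by (intro SUP_cong refl h_A) simp
    also have "\<dots> = P" using cov by blast
    finally show ?thesis by (rule sym)
  qed
  have A_subset: "A s k \<subseteq> P" for s k
    using t(2)[of "s + k"] by (auto simp: A_def)
  have A_disjoint: "A s k \<inter> A s' k' = {}" if "s + k \<noteq> s' + k'" for s k s' k'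
  proof -
    have "\<phi> (t (s + k)) ` B \<inter> \<phi> (t (s' + k')) ` B = {}"
      using t(3) that by (simp add: disjoint_family_on_def)
    moreover have "A s k \<subseteq> \<phi> (t (s + k)) ` B" "A s' k' \<subseteq> \<phi> (t (s' + k')) ` B"
      by (auto simp: A_def)
    ultimately show ?thesis by blast
  qed
  have "m > 0" using cov \<open>P \<noteq> {}\<close> by (cases m) auto
  show ?thesis
    unfolding paradoxical_def
  proof (intro conjI exI)
    show "disjoint_family_on (A 0) {..<m}" "disjoint_family_on (A m) {..<m}"
      using A_disjoint by (auto simp: disjoint_family_on_def)
    show "\<forall>i<m. \<forall>j<m. A 0 i \<inter> A m j = {}"
      using A_disjoint by auto
    show "\<forall>i<m. h 0 i \<in> carrier G" "\<forall>i<m. h m i \<in> carrier G"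
      using g t(1) by (auto simp: h_def)
    show "P = (\<Union>i<m. \<phi> (h 0 i) ` A 0 i)" "P = (\<Union>i<m. \<phi> (h m i) ` A m i)"
      by (rule cover)+
  qed (use P \<open>m > 0\<close> A_subset in auto)
qed

section \<open>Equivariant maps out of free actions\<close>

text \<open>Choose one representative in each orbit. By freeness, a point x of \<open>I\<close>
  determines the group element \<open>w x\<close> that carries the representative to x. Both
  \<open>w (g x)\<close> and \<open>g \<circ> w x\<close> carry the common representative to g x, so
  they agree.\<close>

lemma equivariant_map_of_free_action:
  fixes \<Gamma> :: "('a \<Rightarrow> 'a) set"
  assumes id: "id \<in> \<Gamma>" and comp: "\<And>g h. g \<in> \<Gamma> \<Longrightarrow> h \<in> \<Gamma> \<Longrightarrow> g \<circ> h \<in> \<Gamma>"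
    and inv: "\<And>g. g \<in> \<Gamma> \<Longrightarrow> \<exists>h\<in>\<Gamma>. h \<circ> g = id"
    and stable: "\<And>g x. g \<in> \<Gamma> \<Longrightarrow> x \<in> I \<Longrightarrow> g x \<in> I"
    and free: "\<And>g h x. g \<in> \<Gamma> \<Longrightarrow> h \<in> \<Gamma> \<Longrightarrow> x \<in> I \<Longrightarrow> g x = h x \<Longrightarrow> g = h"
  shows "\<exists>w. \<forall>x\<in>I. w x \<in> \<Gamma> \<and> (\<forall>g\<in>\<Gamma>. w (g x) = g \<circ> w x)"
proof -
  define rep where "rep x = (SOME r. \<exists>g\<in>\<Gamma>. x = g r)" for x
  define w where "w x = (SOME g. g \<in> \<Gamma> \<and> x = g (rep x))" for x
  have "\<exists>r. \<exists>g\<in>\<Gamma>. x = g r" for x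
    using id by (metis id_apply)
  hence "\<exists>g\<in>\<Gamma>. x = g (rep x)" for x
    unfolding rep_def by (rule someI_ex)
  hence "w x \<in> \<Gamma> \<and> x = w x (rep x)" for x
    unfolding w_def by (metis (mono_tags, lifting) someI_ex)
  hence w: "w x \<in> \<Gamma>" "w x (rep x) = x" for x
    by auto
  have rep_I: "rep x \<in> I" if "x \<in> I" for x
    using inv[OF w(1)[of x]] w(2)[of x] stable that by (metis comp_apply id_apply)
  \<comment> \<open>Points of one orbit have the same candidate representatives, so
    \<open>SOME\<close> is applied to equal predicates and picks the same one.\<close>
  have "rep (g x) = rep x" if g: "g \<in> \<Gamma>" for g x
  proof -
    obtain h where h: "h \<in> \<Gamma>" "h \<circ> g = id"
      using inv[OF g] by blast
    have "(\<exists>k\<in>\<Gamma>. g x = k r) \<longleftrightarrow> (\<exists>k\<in>\<Gamma>. x = k r)" for r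
    proof
      assume "\<exists>k\<in>\<Gamma>. g x = k r"
      then obtain k where "k \<in> \<Gamma>" "g x = k r" by blast
      hence "h \<circ> k \<in> \<Gamma>" "x = (h \<circ> k) r"
        using comp h by (auto simp: fun_eq_iff) metis
      thus "\<exists>k\<in>\<Gamma>. x = k r" by blast
    next
      assume "\<exists>k\<in>\<Gamma>. x = k r"
      then obtain k where "k \<in> \<Gamma>" "x = k r" by blast
      hence "g \<circ> k \<in> \<Gamma>" "g x = (g \<circ> k) r"
        using comp g by auto
      thus "\<exists>k\<in>\<Gamma>. g x = k r" by blast
    qed
    thus ?thesis by (simp add: rep_def)
  qed
  hence "w (g x) = g \<circ> w x" if "g \<in> \<Gamma>" "x \<in> I" for g x
    using that w comp rep_I by (intro free[of _ _ "rep x"]) (auto, metis)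
  thus ?thesis using w(1) by blast
qed

section \<open>Packing and covering of the plane by shears over a subring\<close>

text \<open>\<open>lt a b\<close> says that \<open>a\<close> is smaller than \<open>b\<close>; \<open>packing\<close> states, with denominators cleared,
  that the set of fractions \<open>a / b\<close> with \<open>lt a b\<close> has disjoint translates by \<open>S\<close>.\<close>

locale fraction_packing =
  fixes R :: "'k::field set" and lt :: "'k \<Rightarrow> 'k \<Rightarrow> bool" and C S :: "'k set"
  assumes one_R: "1 \<in> R"
    and add_R: "a \<in> R \<Longrightarrow> b \<in> R \<Longrightarrow> a + b \<in> R"
    and uminus_R: "a \<in> R \<Longrightarrow> - a \<in> R"
    and mult_R: "a \<in> R \<Longrightarrow> b \<in> R \<Longrightarrow> a * b \<in> R"
    and C_R: "C \<subseteq> R" and S_R: "S \<subseteq> R"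
    and lt_nonzero: "lt a b \<Longrightarrow> b \<noteq> 0"
    and lt_cases: "a \<in> R \<Longrightarrow> b \<in> R \<Longrightarrow> (a, b) \<noteq> (0, 0) \<Longrightarrow>
      lt (- b) a \<or> (\<exists>c\<in>C. lt (a - c * b) b)"
    and packing: "f \<in> S \<Longrightarrow> g \<in> S \<Longrightarrow> lt a b \<Longrightarrow> lt a' b' \<Longrightarrow>
      (f - g) * (b * b') = a' * b - a * b' \<Longrightarrow> f = g"
begin

text \<open>Encoded as self-maps of the plane, the form that
  \<open>equivariant_map_of_free_action\<close> takes.\<close>

definition SL2 :: "('k \<times> 'k \<Rightarrow> 'k \<times> 'k) set" where
  "SL2 = {\<lambda>(x, y). (p * x + q * y, r * x + s * y) | p q r s.
     p \<in> R \<and> q \<in> R \<and> r \<in> R \<and> s \<in> R \<and> p * s - q * r = 1}"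

lemma SL2_I:
  "\<lbrakk>p \<in> R; q \<in> R; r \<in> R; s \<in> R; p * s - q * r = 1\<rbrakk> \<Longrightarrow>
    (\<lambda>(x, y). (p * x + q * y, r * x + s * y)) \<in> SL2"
  unfolding SL2_def by blast

lemma SL2_E:
  assumes "g \<in> SL2"
  obtains p q r s where "p \<in> R" "q \<in> R" "r \<in> R" "s \<in> R" "p * s - q * r = 1"
    "g = (\<lambda>(x, y). (p * x + q * y, r * x + s * y))"
  using assms unfolding SL2_def by blast

lemma diff_R: "a \<in> R \<Longrightarrow> b \<in> R \<Longrightarrow> a - b \<in> R"
  using add_R[of a "- b"] uminus_R by simp

lemma zero_R: "0 \<in> R"
  using diff_R[OF one_R one_R] by simp

lemma SL2_id: "id \<in> SL2"
proof -
  have "(\<lambda>(x, y). (1 * x + 0 * y, 0 * x + 1 * y)) \<in> SL2"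
    by (intro SL2_I) (auto simp: one_R zero_R)
  moreover have "(\<lambda>(x, y). (1 * x + 0 * y, 0 * x + 1 * y)) = (id :: 'k \<times> 'k \<Rightarrow> _)"
    by auto
  ultimately show ?thesis by simp
qed

lemma SL2_comp:
  assumes "g \<in> SL2" "h \<in> SL2"
  shows "g \<circ> h \<in> SL2"
proof -
  obtain p q r s where g: "p \<in> R" "q \<in> R" "r \<in> R" "s \<in> R" "p * s - q * r = 1"
    "g = (\<lambda>(x, y). (p * x + q * y, r * x + s * y))"
    using assms(1) by (rule SL2_E)
  obtain p' q' r' s' where h: "p' \<in> R" "q' \<in> R" "r' \<in> R" "s' \<in> R" "p' * s' - q' * r' = 1"
    "h = (\<lambda>(x, y). (p' * x + q' * y, r' * x + s' * y))"
    using assms(2) by (rule SL2_E)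
  have "(p * p' + q * r') * (r * q' + s * s') - (p * q' + q * s') * (r * p' + s * r') =
      (p * s - q * r) * (p' * s' - q' * r')"
    by (simp add: algebra_simps)
  hence "(\<lambda>(x, y). ((p * p' + q * r') * x + (p * q' + q * s') * y,
      (r * p' + s * r') * x + (r * q' + s * s') * y)) \<in> SL2"
    using g h by (intro SL2_I add_R mult_R) auto
  moreover have "g \<circ> h = (\<lambda>(x, y). ((p * p' + q * r') * x + (p * q' + q * s') * y,
      (r * p' + s * r') * x + (r * q' + s * s') * y))"
    by (auto simp: g h algebra_simps)
  ultimately show ?thesis by simp
qed

lemma SL2_inv:
  assumes "g \<in> SL2"
  shows "\<exists>h\<in>SL2. h \<circ> g = id"
proof -
  obtain p q r s where g: "p \<in> R" "q \<in> R" "r \<in> R" "s \<in> R" "p * s - q * r = 1"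
    "g = (\<lambda>(x, y). (p * x + q * y, r * x + s * y))"
    using assms by (rule SL2_E)
  have "(\<lambda>(x, y). (s * x + (- q) * y, (- r) * x + p * y)) \<in> SL2"
    using g by (intro SL2_I uminus_R) (auto simp: algebra_simps)
  moreover have "s * (p * x + q * y) - q * (r * x + s * y) = (p * s - q * r) * x"
    "p * (r * x + s * y) - r * (p * x + q * y) = (p * s - q * r) * y" for x y
    by (simp_all add: algebra_simps)
  hence "(\<lambda>(x, y). (s * x + (- q) * y, (- r) * x + p * y)) \<circ> g = id"
    using g by (auto simp: fun_eq_iff)
  ultimately show ?thesis by blast
qed

lemma SL2_zero: "g \<in> SL2 \<Longrightarrow> g (0, 0) = (0, 0)"
  by (auto elim!: SL2_E)

lemma SL2_nonzero: "g \<in> SL2 \<Longrightarrow> z \<noteq> (0, 0) \<Longrightarrow> g z \<noteq> (0, 0)"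
  using SL2_inv[of g] SL2_zero by (metis comp_apply id_apply)

lemma SL2_shear: "f \<in> R \<Longrightarrow> (\<lambda>(x, y). (x + f * y, y)) \<in> SL2"
  using SL2_I[of 1 f 0 1] one_R zero_R by simp

lemma SL2_rotation: "(\<lambda>(x, y). (y, - x)) \<in> SL2"
  using SL2_I[of 0 1 "- 1" 0] one_R zero_R uminus_R by simp

text \<open>The equation says that (x, y) and (a, b) are proportional, so these are the vectors on
  no line through a nonzero vector of R^2. The origin is excluded, since every (a, b) satisfies its
  equation.\<close>

definition irrational :: "('k \<times> 'k) set" where
  "irrational = {(x, y). \<forall>a\<in>R. \<forall>b\<in>R. x * b = y * a \<longrightarrow> a = 0 \<and> b = 0}"

text \<open>A vector (a, b) over \<open>R\<close> proportional to g z pulls back under the inverse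
  matrix to (s a - q b, p b - r a), which is again over \<open>R\<close> and proportional to z. As
  the determinant is 1, it vanishes only together with (a, b).\<close>

lemma irrational_stable:
  assumes "g \<in> SL2" "z \<in> irrational"
  shows "g z \<in> irrational"
proof -
  obtain p q r s where g: "p \<in> R" "q \<in> R" "r \<in> R" "s \<in> R" "p * s - q * r = 1"
    "g = (\<lambda>(x, y). (p * x + q * y, r * x + s * y))"
    using assms(1) by (rule SL2_E)
  obtain x y where z: "z = (x, y)" by (cases z)
  have "a = 0 \<and> b = 0"
    if "a \<in> R" "b \<in> R" "(p * x + q * y) * b = (r * x + s * y) * a" for a b
  proof -
    have "x * (p * b - r * a) = y * (s * a - q * b)"
      using that(3) by (simp add: algebra_simps)
    moreover have "p * b - r * a \<in> R" "s * a - q * b \<in> R"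
      using that g by (auto intro: diff_R mult_R)
    ultimately have *: "s * a - q * b = 0" "p * b - r * a = 0"
      using assms(2) unfolding irrational_def z by blast+
    have "(p * s - q * r) * a = p * (s * a - q * b) + q * (p * b - r * a)"
      "(p * s - q * r) * b = r * (s * a - q * b) + s * (p * b - r * a)"
      by (simp_all add: algebra_simps)
    thus ?thesis unfolding * g(5) by simp
  qed
  thus ?thesis
    unfolding irrational_def z g(6) mem_Collect_eq prod.case by blast
qed

text \<open>Each row of the difference of the two matrices is a linear relation over
  \<open>R\<close> between the coordinates of z, hence zero.\<close>

lemma irrational_free:
  assumes "g \<in> SL2" "h \<in> SL2" "z \<in> irrational" "g z = h z"
  shows "g = h"
proof -
  obtain p q r s where g: "p \<in> R" "q \<in> R" "r \<in> R" "s \<in> R"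
    "g = (\<lambda>(x, y). (p * x + q * y, r * x + s * y))"
    using assms(1) by (rule SL2_E)
  obtain p' q' r' s' where h: "p' \<in> R" "q' \<in> R" "r' \<in> R" "s' \<in> R"
    "h = (\<lambda>(x, y). (p' * x + q' * y, r' * x + s' * y))"
    using assms(2) by (rule SL2_E)
  obtain x y where z: "z = (x, y)" by (cases z)
  have "x * (p - p') = y * (q' - q)" "x * (r - r') = y * (s' - s)"
    using assms(4) by (auto simp: g h z algebra_simps)
  moreover have "p - p' \<in> R" "q' - q \<in> R" "r - r' \<in> R" "s' - s \<in> R"
    using g h by (auto intro: diff_R)
  ultimately have "p - p' = 0" "q' - q = 0" "r - r' = 0" "s' - s = 0"
    using assms(3) unfolding irrational_def z by blast+
  thus ?thesis by (simp add: g h)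
qed

text \<open>The irrational vectors are sent equivariantly into the orbit of (1, 0) by means of the
  free action; on all other vectors the identity serves. Both sets are stable under the group, so
  the two maps fit together.\<close>

lemma equivariant_map_to_rational:
  obtains \<psi> where "\<And>z. z \<noteq> (0, 0) \<Longrightarrow> \<psi> z \<noteq> (0, 0) \<and> \<psi> z \<notin> irrational"
    "\<And>g z. g \<in> SL2 \<Longrightarrow> z \<noteq> (0, 0) \<Longrightarrow> \<psi> (g z) = g (\<psi> z)"
proof -
  have "\<exists>w. \<forall>z\<in>irrational. w z \<in> SL2 \<and> (\<forall>g\<in>SL2. w (g z) = g \<circ> w z)"
    by (rule equivariant_map_of_free_action[of SL2 irrational])
      (assumption | rule SL2_id | erule (1) SL2_comp | erule SL2_inv
        | erule (1) irrational_stable | erule (3) irrational_free)+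
  then obtain w where w: "\<And>z. z \<in> irrational \<Longrightarrow> w z \<in> SL2"
    "\<And>g z. g \<in> SL2 \<Longrightarrow> z \<in> irrational \<Longrightarrow> w (g z) = g \<circ> w z"
    by blast
  have irr_iff: "g z \<in> irrational \<longleftrightarrow> z \<in> irrational" if "g \<in> SL2" for g z
    using SL2_inv[OF that] irrational_stable that by (metis comp_apply id_apply)
  have e1: "(1, 0) \<notin> irrational"
    using one_R zero_R by (auto simp: irrational_def intro!: bexI[of _ 1])
  define \<psi> where "\<psi> z = (if z \<in> irrational then w z (1, 0) else z)" for z
  show thesis
  proof (rule that)
    show "\<psi> z \<noteq> (0, 0) \<and> \<psi> z \<notin> irrational" if "z \<noteq> (0, 0)" for z
      using that w(1) SL2_nonzero irr_iff e1 by (auto simp: \<psi>_def)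
    show "\<psi> (g z) = g (\<psi> z)" if "g \<in> SL2" "z \<noteq> (0, 0)" for g z
      using that w(2) irr_iff by (auto simp: \<psi>_def)
  qed
qed

text \<open>The cone of nonzero vectors with x / y = a / b for some \<open>lt a b\<close> has the
  packing property, and the covering property for rational vectors. Shears and the rotation commute
  with the equivariant map into the rational vectors, so the preimage of the cone has both
  properties on all nonzero vectors.\<close>

lemma shear_packing_covering:
  obtains W where
    "\<And>f g x y x' y'. \<lbrakk>f \<in> S; g \<in> S; (x, y) \<in> W; (x', y') \<in> W;
      (x + f * y, y) = (x' + g * y', y')\<rbrakk> \<Longrightarrow> f = g"
    "\<And>x y. (x, y) \<noteq> (0, 0) \<Longrightarrow> (y, - x) \<in> W \<or> (\<exists>c\<in>C. (x - c * y, y) \<in> W)"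
proof -
  obtain \<psi> where \<psi>: "\<And>z. z \<noteq> (0, 0) \<Longrightarrow> \<psi> z \<noteq> (0, 0) \<and> \<psi> z \<notin> irrational"
    "\<And>g z. g \<in> SL2 \<Longrightarrow> z \<noteq> (0, 0) \<Longrightarrow> \<psi> (g z) = g (\<psi> z)"
    using equivariant_map_to_rational by blast
  define cone where "cone = {(x, y). (x, y) \<noteq> (0, 0) \<and> (\<exists>a b. lt a b \<and> x * b = y * a)}"
  define W where "W = {z. z \<noteq> (0, 0) \<and> \<psi> z \<in> cone}"
  have \<psi>_shear: "\<psi> (x + f * y, y) = (fst (\<psi> (x, y)) + f * snd (\<psi> (x, y)), snd (\<psi> (x, y)))"
    if "f \<in> R" "(x, y) \<noteq> (0, 0)" for f x y
    using \<psi>(2)[OF SL2_shear[OF that(1)] that(2)] by (simp add: split_beta)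
  have \<psi>_rotation: "\<psi> (y, - x) = (snd (\<psi> (x, y)), - fst (\<psi> (x, y)))"
    if "(x, y) \<noteq> (0, 0)" for x y
    using \<psi>(2)[OF SL2_rotation that] by (simp add: split_beta)
  have cone_packing: "f = g"
    if fg: "f \<in> S" "g \<in> S" "(x, y) \<in> cone" "(x', y') \<in> cone" "x + f * y = x' + g * y'" "y = y'"
    for f g x y x' y'
  proof -
    obtain a b a' b' where ab: "lt a b" "x * b = y * a" "lt a' b'" "x' * b' = y * a'"
      and nz: "(x, y) \<noteq> (0, 0)"
      using fg(3,4,6) by (auto simp: cone_def)
    have "y \<noteq> 0"
      using lt_nonzero[OF ab(1)] ab(2) nz by auto
    have "x + f * y = x' + g * y" using fg by simp
    hence "y * (f - g) = x' - x" by (simp add: algebra_simps)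
    \<comment> \<open>Multiplying by both denominators replaces x b by y a and x' b' by y a';
      cancelling y then gives the form required by \<open>packing\<close>.\<close>
    hence "y * ((f - g) * (b * b')) = (x' - x) * (b * b')"
      by (metis mult.assoc)
    also have "\<dots> = (x' * b') * b - (x * b) * b'"
      by (simp add: algebra_simps)
    also have "\<dots> = y * (a' * b - a * b')"
      unfolding ab by (simp add: algebra_simps)
    finally have "(f - g) * (b * b') = a' * b - a * b'"
      using \<open>y \<noteq> 0\<close> by simp
    thus ?thesis using packing fg ab by blast
  qed
  have cone_cover: "(y, - x) \<in> cone \<or> (\<exists>c\<in>C. (x - c * y, y) \<in> cone)"
    if xy: "(x, y) \<noteq> (0, 0)" "(x, y) \<notin> irrational" for x y
  proof -
    obtain a b where ab: "a \<in> R" "b \<in> R" "x * b = y * a" "(a, b) \<noteq> (0, 0)"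
      using xy(2) by (auto simp: irrational_def)
    from lt_cases[OF ab(1,2,4)] show ?thesis
    proof (elim disjE bexE)
      assume "lt (- b) a"
      moreover have "y * a = (- x) * (- b)" using ab(3) by simp
      ultimately have "\<exists>a b. lt a b \<and> y * b = (- x) * a" by blast
      hence "(y, - x) \<in> cone" using xy(1) by (auto simp: cone_def)
      thus ?thesis ..
    next
      fix c assume c: "c \<in> C" "lt (a - c * b) b"
      moreover have "(x - c * y) * b = y * (a - c * b)"
        using ab(3) by (simp add: algebra_simps)
      ultimately have "\<exists>a b. lt a b \<and> (x - c * y) * b = y * a" by blast
      hence "(x - c * y, y) \<in> cone" using xy(1) by (auto simp: cone_def)
      thus ?thesis using c(1) by blast
    qed
  qed
  show thesis
  proof (rule that[of W])
    show "f = g" if fg: "f \<in> S" "g \<in> S" "(x, y) \<in> W" "(x', y') \<in> W"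
      "(x + f * y, y) = (x' + g * y', y')" for f g x y x' y'
    proof -
      have "\<psi> (x + f * y, y) = \<psi> (x' + g * y', y')" by (rule arg_cong[OF fg(5)])
      moreover have "f \<in> R" "g \<in> R" "(x, y) \<noteq> (0, 0)" "(x', y') \<noteq> (0, 0)"
        using fg S_R by (auto simp: W_def)
      ultimately have "(fst (\<psi> (x, y)) + f * snd (\<psi> (x, y)), snd (\<psi> (x, y))) =
          (fst (\<psi> (x', y')) + g * snd (\<psi> (x', y')), snd (\<psi> (x', y')))"
        using \<psi>_shear[of f x y] \<psi>_shear[of g x' y'] by metis
      note eq = iffD1[OF prod.inject this]
      have "\<psi> (x, y) \<in> cone" "\<psi> (x', y') \<in> cone"
        using fg by (auto simp: W_def)
      thus ?thesis
        using cone_packing[OF fg(1,2) _ _ conjunct1[OF eq] conjunct2[OF eq]] by simp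
    qed
    show "(y, - x) \<in> W \<or> (\<exists>c\<in>C. (x - c * y, y) \<in> W)" if xy: "(x, y) \<noteq> (0, 0)" for x y
    proof -
      have "\<psi> (x - c * y, y) = (fst (\<psi> (x, y)) - c * snd (\<psi> (x, y)), snd (\<psi> (x, y)))"
        if "c \<in> C" for c
        using \<psi>_shear[of "- c" x y] xy that C_R uminus_R by auto
      thus ?thesis
        using cone_cover[of "fst (\<psi> (x, y))" "snd (\<psi> (x, y))"] \<psi>(1)[OF xy] \<psi>_rotation[OF xy] xy
        by (auto simp: W_def)
    qed
  qed
qed

end

section \<open>Characteristic zero: fractions of integers\<close>

lemma fraction_packing_char_0:
  assumes "inj (of_int :: int \<Rightarrow> 'k::field)"
  shows "fraction_packing (\<int> :: 'k set)
    (\<lambda>a b. \<exists>i j. a = of_int i \<and> b = of_int j \<and> \<bar>i\<bar> < \<bar>j\<bar>) {0, 1, - 1}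
    (range (\<lambda>i. of_int (2 * i)))"
  \<comment> \<open>The fractions fill \<open>]-1, 1[\<close>, hence translates by even integers only.\<close>
proof
  have eq: "of_int i = (of_int j :: 'k) \<longleftrightarrow> i = j" for i j
    using assms by (auto dest: injD)
  have eq0: "of_int i = (0 :: 'k) \<longleftrightarrow> i = 0" for i
    using eq[of i 0] by simp
  fix a b :: 'k
  show "b \<noteq> 0" if "\<exists>i j. a = of_int i \<and> b = of_int j \<and> \<bar>i\<bar> < \<bar>j\<bar>"
    using that by (auto simp: eq0)
  show "(\<exists>i j. - b = of_int i \<and> a = of_int j \<and> \<bar>i\<bar> < \<bar>j\<bar>) \<or>
      (\<exists>c\<in>{0, 1, - 1}. \<exists>i j. a - c * b = of_int i \<and> b = of_int j \<and> \<bar>i\<bar> < \<bar>j\<bar>)"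
    if R: "a \<in> \<int>" "b \<in> \<int>" and nz: "(a, b) \<noteq> (0, 0)"
  proof -
    obtain i j where ij: "a = of_int i" "b = of_int j"
      using R by (auto elim!: Ints_cases)
    have "i \<noteq> 0 \<or> j \<noteq> 0" using nz by (auto simp: ij)
    \<comment> \<open>If the absolute values differ, the rotation or c = 0 suffices. If they agree,
      subtracting c b with c = 1 or c = -1 leaves numerator 0.\<close>
    then consider "\<bar>- j\<bar> < \<bar>i\<bar>" | "\<bar>i\<bar> < \<bar>j\<bar>" | "i = j" "\<bar>0\<bar> < \<bar>j\<bar>" | "i = - j" "\<bar>0\<bar> < \<bar>j\<bar>"
      by linarith
    thus ?thesis
    proof cases
      case 1
      thus ?thesis using ij by (metis of_int_minus)
    next
      case 2
      thus ?thesis using ij by auto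
    next
      case 3
      hence "a - 1 * b = of_int 0" by (simp add: ij)
      thus ?thesis using 3 ij by blast
    next
      case 4
      hence "a - (- 1) * b = of_int 0" by (simp add: ij)
      thus ?thesis using 4 ij by blast
    qed
  qed
  fix f g a' b' :: 'k
  assume fg: "f \<in> range (\<lambda>i. of_int (2 * i))" "g \<in> range (\<lambda>i. of_int (2 * i))"
    and lt: "\<exists>i j. a = of_int i \<and> b = of_int j \<and> \<bar>i\<bar> < \<bar>j\<bar>"
      "\<exists>i j. a' = of_int i \<and> b' = of_int j \<and> \<bar>i\<bar> < \<bar>j\<bar>"
    and *: "(f - g) * (b * b') = a' * b - a * b'"
  obtain m n where mn: "f = of_int (2 * m)" "g = of_int (2 * n)"
    using fg by blast
  obtain i j i' j' where ij: "a = of_int i" "b = of_int j" "\<bar>i\<bar> < \<bar>j\<bar>"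
    "a' = of_int i'" "b' = of_int j'" "\<bar>i'\<bar> < \<bar>j'\<bar>"
    using lt by blast
  have "of_int ((2 * m - 2 * n) * (j * j')) = (of_int (i' * j - i * j') :: 'k)"
    using * by (simp add: mn ij)
  hence **: "2 * (m - n) * (j * j') = i' * j - i * j'"
    unfolding eq by (simp add: algebra_simps)
  have "m = n"
  proof (rule ccontr)
    \<comment> \<open>For distinct m and n the left side of \<open>**\<close> has absolute value at
      least 2 |j j'|, whereas the right side stays strictly below this bound.\<close>
    assume "m \<noteq> n"
    hence "2 * (\<bar>j\<bar> * \<bar>j'\<bar>) \<le> \<bar>2 * (m - n)\<bar> * (\<bar>j\<bar> * \<bar>j'\<bar>)"
      by (intro mult_right_mono) auto
    also have "\<dots> = \<bar>i' * j - i * j'\<bar>"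
      unfolding **[symmetric] by (simp only: abs_mult)
    also have "\<dots> \<le> \<bar>i'\<bar> * \<bar>j\<bar> + \<bar>i\<bar> * \<bar>j'\<bar>"
      using abs_triangle_ineq4[of "i' * j" "i * j'"] by (simp only: abs_mult)
    also have "\<bar>i'\<bar> * \<bar>j\<bar> < \<bar>j'\<bar> * \<bar>j\<bar>"
      using ij by (intro mult_strict_right_mono) auto
    also have "\<bar>i\<bar> * \<bar>j'\<bar> \<le> \<bar>j\<bar> * \<bar>j'\<bar>"
      using ij by (intro mult_right_mono) auto
    finally show False by (simp add: mult.commute)
  qed
  thus "f = g" by (simp add: mn)
qed auto

section \<open>Positive characteristic: fractions of polynomials over the prime field\<close>

text \<open>Two integers with the same image differ by some d > 0 that vanishes in the ring, so
  every integer may be replaced by its remainder modulo d.\<close>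

lemma finite_Ints_if_not_inj:
  assumes "\<not> inj (of_int :: int \<Rightarrow> 'k::ring_1)"
  shows "finite (\<int> :: 'k set)"
proof -
  obtain a b :: int where "of_int a = (of_int b :: 'k)" "a < b"
    using assms unfolding inj_def by (metis linorder_neqE)
  define d where "d = b - a"
  have d: "d > 0" "of_int d = (0 :: 'k)"
    using \<open>a < b\<close> \<open>of_int a = _\<close> by (auto simp: d_def)
  have "of_int x = (of_int (x mod d) :: 'k)" for x
  proof -
    have "(of_int x :: 'k) = of_int (d * (x div d) + x mod d)" by simp
    also have "\<dots> = of_int (x mod d)" unfolding of_int_add of_int_mult d by simp
    finally show ?thesis .
  qed
  hence "\<int> \<subseteq> (of_int ` {0..<d} :: 'k set)"
    using d(1) by (auto elim!: Ints_cases) (metis atLeastLessThan_iff image_eqI pos_mod_bound pos_mod_sign)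
  thus ?thesis by (rule finite_subset) simp
qed

text \<open>By the pigeonhole principle two powers of c coincide, and c can be cancelled.\<close>

lemma finite_Ints_root_of_unity:
  fixes c :: "'k::field"
  assumes "finite (\<int> :: 'k set)" "c \<in> \<int>" "c \<noteq> 0"
  obtains m where "c ^ Suc m = 1"
proof -
  have "range (\<lambda>i::nat. c ^ i) \<subseteq> \<int>"
    using assms(2) by auto
  hence "\<not> inj (\<lambda>i::nat. c ^ i)"
    using assms(1) finite_subset infinite_UNIV_nat finite_imageD by blast
  then obtain i j :: nat where "c ^ i = c ^ j" "i < j"
    unfolding inj_def by (metis linorder_neqE_nat)
  then obtain m where "j = i + Suc m"
    using less_iff_Suc_add by auto
  hence "c ^ i * c ^ Suc m = c ^ i * 1"
    using \<open>c ^ i = c ^ j\<close> by (simp only: power_add mult_1_right)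
  thus thesis using that assms(3) by simp
qed

text \<open>Inverses of leading coefficients stay in the prime field, which makes division with
  remainder possible.\<close>

lemma finite_Ints_inverse:
  fixes c :: "'k::field"
  assumes "finite (\<int> :: 'k set)" "c \<in> \<int>"
  shows "inverse c \<in> \<int>"
proof (cases "c = 0")
  case False
  then obtain m where "c ^ Suc m = 1"
    using finite_Ints_root_of_unity assms by blast
  hence "inverse c = c ^ m"
    by (intro inverse_unique) simp
  thus ?thesis using assms(2) by simp
qed auto

text \<open>When \<open>\<int>\<close> is finite, these are the polynomials over the prime field.
  They are kept among the polynomials over the whole field so that \<open>poly\<close> evaluates
  them there directly.\<close>

definition int_poly :: "'k::ring_1 poly \<Rightarrow> bool" where
  "int_poly P \<longleftrightarrow> (\<forall>i. coeff P i \<in> \<int>)"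

lemma int_poly_pCons: "int_poly (pCons a P) \<longleftrightarrow> a \<in> \<int> \<and> int_poly P"
  unfolding int_poly_def by (auto simp: coeff_pCons split: nat.splits)

lemma int_poly_closed:
  fixes P Q :: "'k::comm_ring_1 poly"
  assumes "int_poly P" "int_poly Q"
  shows "int_poly (P + Q)" "int_poly (P - Q)" "int_poly (P * Q)"
  using assms by (auto simp: int_poly_def coeff_mult intro!: Ints_sum Ints_mult)

lemma int_poly_uminus: "int_poly P \<Longrightarrow> int_poly (- P)"
  by (auto simp: int_poly_def)

lemma int_poly_const: "int_poly [:c:] \<longleftrightarrow> c \<in> \<int>"
  unfolding int_poly_pCons by (simp add: int_poly_def)

context nonarch_valuation
begin

lemma v_of_nat_le_1: "v (of_nat n) \<le> 1"
  by (induction n) (auto intro: v_add_le)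

lemma v_Ints_le_1: "c \<in> \<int> \<Longrightarrow> v c \<le> 1"
  by (cases c rule: Ints_cases, simp) (metis abs_of_nat int_cases2 of_int_minus of_int_of_nat_eq v_of_nat_le_1 v_uminus)

lemma v_power: "v (x ^ n) = v x ^ n"
  by (induction n) (auto simp: mult)

lemma v_finite_Ints:
  assumes "finite (\<int> :: 'k set)" "c \<in> \<int>" "c \<noteq> 0"
  shows "v c = 1"
proof -
  obtain m where "c ^ Suc m = 1"
    using finite_Ints_root_of_unity assms by blast
  hence "v c ^ Suc m = 1"
    by (metis v_power v_1)
  thus ?thesis using nonneg[of c] power_eq_iff_eq_base[of "Suc m" "v c" 1] by simp
qed

lemma v_int_poly_le_1: "int_poly P \<Longrightarrow> v x \<le> 1 \<Longrightarrow> v (poly P x) \<le> 1"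
  by (induction P) (auto simp: int_poly_pCons intro: v_add_le v_mult_le_1 v_Ints_le_1)

text \<open>This says that t is transcendental over the prime field. If a + t P(t) = 0, then a has
  valuation at most \<open>v t\<close> < 1, while nonzero elements of the prime field have valuation
  1. So a = 0, and P(t) = 0 as well.\<close>

lemma int_poly_root_imp_zero:
  assumes "finite (\<int> :: 'k set)" "0 < v t" "v t < 1" "int_poly P" "poly P t = 0"
  shows "P = 0"
  using assms(4,5)
proof (induction P)
  case (pCons a P)
  have a: "a \<in> \<int>" and P: "int_poly P" using pCons.prems(1) by (auto simp: int_poly_pCons)
  have "a = - (t * poly P t)"
    using pCons.prems(2) by (simp add: eq_neg_iff_add_eq_0)
  hence "v a = v t * v (poly P t)"
    by (simp add: mult)
  also have "\<dots> \<le> v t * 1"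
    using v_int_poly_le_1[OF P] assms(3) nonneg by (intro mult_left_mono) auto
  finally have "v a < 1" using assms(3) by simp
  hence "a = 0" using v_finite_Ints[OF assms(1) a] by auto
  moreover have "t \<noteq> 0" using assms(2) by auto
  ultimately have "poly P t = 0" using pCons.prems(2) by simp
  thus ?case using pCons.IH P \<open>a = 0\<close> by simp
qed simp

lemma int_poly_eq:
  assumes "finite (\<int> :: 'k set)" "0 < v t" "v t < 1" "int_poly P" "int_poly Q" "poly P t = poly Q t"
  shows "P = Q"
  using int_poly_root_imp_zero[OF assms(1-3) int_poly_closed(2)[OF assms(4,5)]] assms(6) by simp

text \<open>Size is measured by degree. Proper fractions differ by a proper fraction, never by a
  nonzero polynomial, so all of F_p[t] can serve as translates. The disjunct \<open>P = 0\<close> is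
  there because the zero polynomial has degree 0 and must still count as smaller than a nonzero
  constant.\<close>

lemma fraction_packing_char_p:
  assumes fin: "finite (\<int> :: 'k set)" and t: "0 < v t" "v t < 1"
  shows "fraction_packing {poly P t | P. int_poly P}
    (\<lambda>a b. \<exists>P Q. int_poly P \<and> int_poly Q \<and> a = poly P t \<and> b = poly Q t \<and> Q \<noteq> 0 \<and>
      (P = 0 \<or> degree P < degree Q)) \<int> {poly P t | P. int_poly P}"
    (is "fraction_packing ?R ?lt _ _")
proof
  show "1 \<in> ?R" by (rule CollectI, rule exI[of _ "[:1:]"]) (simp add: int_poly_const)
  show "\<int> \<subseteq> ?R"
  proof
    fix c :: 'k assume "c \<in> \<int>"
    hence "c = poly [:c:] t" "int_poly [:c:]" by (auto simp: int_poly_const)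
    thus "c \<in> ?R" by blast
  qed
  fix a b :: 'k
  show "b \<noteq> 0" if "?lt a b"
    using that int_poly_root_imp_zero[OF fin t] by auto
  show "- a \<in> ?R" if "a \<in> ?R"
    using that by (clarsimp, metis int_poly_uminus poly_minus)
  show "a + b \<in> ?R" if "a \<in> ?R" "b \<in> ?R"
    using that by (clarsimp, metis int_poly_closed(1) poly_add)
  show "a * b \<in> ?R" if "a \<in> ?R" "b \<in> ?R"
    using that by (clarsimp, metis int_poly_closed(3) poly_mult)
  show "?lt (- b) a \<or> (\<exists>c\<in>\<int>. ?lt (a - c * b) b)" if ab: "a \<in> ?R" "b \<in> ?R" "(a, b) \<noteq> (0, 0)"
  proof -
    obtain P Q where P: "int_poly P" "a = poly P t" and Q: "int_poly Q" "b = poly Q t"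
      using ab by blast
    show ?thesis
    proof (cases "P \<noteq> 0 \<and> (Q = 0 \<or> degree Q < degree P)")
      case True
      hence "?lt (- b) a"
        using P Q int_poly_uminus
        by (intro exI[of _ "- Q"] exI[of _ P]) auto
      thus ?thesis ..
    next
      case False
      hence "Q \<noteq> 0" using P Q ab by auto
      \<comment> \<open>One step of polynomial division: c cancels the coefficient in degree
        \<open>degree Q\<close>. If P has smaller degree, then c = 0.\<close>
      define c where "c = coeff P (degree Q) * inverse (lead_coeff Q)"
      have c: "c \<in> \<int>"
        using P Q finite_Ints_inverse[OF fin] by (auto simp: c_def int_poly_def)
      have "degree P \<le> degree Q" using False \<open>Q \<noteq> 0\<close> by auto
      hence "degree (P - smult c Q) \<le> degree Q"
        by (intro degree_diff_le) (auto intro: degree_smult_le)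
      moreover have "coeff (P - smult c Q) (degree Q) = 0"
        using \<open>Q \<noteq> 0\<close> by (simp add: c_def)
      ultimately have "P - smult c Q = 0 \<or> degree (P - smult c Q) < degree Q"
        by (rule eq_zero_or_degree_less)
      moreover have "int_poly (P - smult c Q)"
        using P Q c by (auto simp: int_poly_def)
      moreover have "a - c * b = poly (P - smult c Q) t"
        by (simp add: P Q)
      ultimately have "?lt (a - c * b) b"
        using Q \<open>Q \<noteq> 0\<close> by blast
      thus ?thesis using c by blast
    qed
  qed
  fix f g a' b' :: 'k
  assume fg: "f \<in> ?R" "g \<in> ?R" and lt: "?lt a b" "?lt a' b'"
    and *: "(f - g) * (b * b') = a' * b - a * b'"
  obtain F H where FH: "int_poly F" "f = poly F t" "int_poly H" "g = poly H t"
    using fg by blast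
  obtain P Q where PQ: "int_poly P" "int_poly Q" "a = poly P t" "b = poly Q t" "Q \<noteq> 0"
    "P = 0 \<or> degree P < degree Q"
    using lt(1) by blast
  obtain P' Q' where PQ': "int_poly P'" "int_poly Q'" "a' = poly P' t" "b' = poly Q' t" "Q' \<noteq> 0"
    "P' = 0 \<or> degree P' < degree Q'"
    using lt(2) by blast
  \<comment> \<open>Transcendence of t lifts the identity of values to one of polynomials, where
    degrees can be compared.\<close>
  have eq: "(F - H) * (Q * Q') = P' * Q - P * Q'"
  proof (rule int_poly_eq[OF fin t])
    show "poly ((F - H) * (Q * Q')) t = poly (P' * Q - P * Q') t"
      using * by (simp add: FH PQ PQ')
  qed (intro int_poly_closed FH PQ PQ')+
  have "F - H = 0"
  proof (rule ccontr)
    assume nz: "F - H \<noteq> 0"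
    define d where "d = degree Q + degree Q'"
    have 1: "P' * Q = 0 \<or> degree (P' * Q) < d"
      using PQ PQ' by (cases "P' = 0") (auto simp: d_def degree_mult_eq)
    have 2: "P * Q' = 0 \<or> degree (P * Q') < d"
      using PQ PQ' by (cases "P = 0") (auto simp: d_def degree_mult_eq)
    have "degree ((F - H) * (Q * Q')) \<ge> d"
      using nz PQ PQ' by (simp add: degree_mult_eq d_def)
    moreover have "(F - H) * (Q * Q') \<noteq> 0"
      using nz PQ PQ' by simp
    ultimately have 3: "P' * Q - P * Q' \<noteq> 0" "degree (P' * Q - P * Q') \<ge> d"
      unfolding eq by auto
    show False
      using 1 2 3 degree_diff_le_max[of "P' * Q" "P * Q'"] by auto
  qed
  thus "f = g" by (simp add: FH)
qed auto

end

section \<open>Packing and covering over a discretely valued field\<close>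

context discrete_valuation
begin

lemma uniformizer:
  obtains t where "0 < v t" "v t < 1" "\<And>x. v x < 1 \<Longrightarrow> v x \<le> v t"
proof -
  obtain r where r: "r \<in> value_group v" "0 < r" "r < 1"
    "\<And>s. s \<in> value_group v \<inter> {0<..<1} \<Longrightarrow> s \<le> r"
    using discrete by auto
  obtain t where t: "r = v t" using r(1) by (auto simp: value_group_def)
  have "v x \<le> v t" if "v x < 1" for x
  proof (cases "x = 0")
    case False
    hence "v x > 0" using nonneg[of x] eq_0_iff[of x] by linarith
    thus ?thesis using r(4)[of "v x"] that False t by (auto simp: value_group_def)
  qed (use r t in auto)
  thus thesis using that r t by blast
qed

lemma exists_small:
  assumes "\<epsilon> > 0"
  obtains d where "d \<noteq> 0" "v d \<le> \<epsilon>"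
proof -
  obtain t where t: "0 < v t" "v t < 1" using uniformizer by blast
  then obtain n where "v t ^ n < \<epsilon>" using real_arch_pow_inv[OF assms] by blast
  moreover have "t \<noteq> 0" using t by auto
  ultimately show thesis using that[of "t ^ n"] by (simp add: v_power)
qed

text \<open>Injectivity of \<open>of_int\<close> separates the two characteristics. In the second
  case \<open>\<int>\<close> is finite and can be taken as \<open>C\<close>, and the powers of t
  make \<open>S\<close> infinite. The bounds on \<open>v\<close> ensure that the resulting shears
  are integral.\<close>

lemma shear_packing_covering:
  obtains C S W where "finite C" "infinite S" "\<And>c. c \<in> C \<Longrightarrow> v c \<le> 1" "\<And>f. f \<in> S \<Longrightarrow> v f \<le> 1"
    "\<And>f g x y x' y'. \<lbrakk>f \<in> S; g \<in> S; (x, y) \<in> W; (x', y') \<in> W;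
      (x + f * y, y) = (x' + g * y', y')\<rbrakk> \<Longrightarrow> f = g"
    "\<And>x y. (x, y) \<noteq> (0, 0) \<Longrightarrow> (y, - x) \<in> W \<or> (\<exists>c\<in>C. (x - c * y, y) \<in> W)"
proof (cases "inj (of_int :: int \<Rightarrow> 'k)")
  case True
  interpret fraction_packing "\<int> :: 'k set"
    "\<lambda>a b. \<exists>i j. a = of_int i \<and> b = of_int j \<and> \<bar>i\<bar> < \<bar>j\<bar>" "{0, 1, - 1}" "range (\<lambda>i. of_int (2 * i))"
    using True by (rule fraction_packing_char_0)
  have "infinite (range (\<lambda>i. of_int (2 * i) :: 'k))"
  proof -
    have "inj (\<lambda>i. of_int (2 * i) :: 'k)"
      using True by (intro injI) (auto dest: injD simp del: of_int_mult)
    thus ?thesis by (meson finite_imageD infinite_UNIV_int)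
  qed
  show thesis
  proof (rule shear_packing_covering)
    fix W :: "('k \<times> 'k) set"
    assume W: "\<And>f g x y x' y'. \<lbrakk>f \<in> range (\<lambda>i. of_int (2 * i)); g \<in> range (\<lambda>i. of_int (2 * i));
        (x, y) \<in> W; (x', y') \<in> W; (x + f * y, y) = (x' + g * y', y')\<rbrakk> \<Longrightarrow> f = g"
      "\<And>x y. (x, y) \<noteq> (0, 0) \<Longrightarrow> (y, - x) \<in> W \<or> (\<exists>c\<in>{0, 1, - 1}. (x - c * y, y) \<in> W)"
    show thesis
      by (rule that[of "{0, 1, - 1}" "range (\<lambda>i. of_int (2 * i))" W, OF _ \<open>infinite _\<close> _ _ W])
        (auto intro: v_Ints_le_1 simp del: of_int_mult)
  qed
next
  case False
  hence fin: "finite (\<int> :: 'k set)" by (rule finite_Ints_if_not_inj)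
  obtain t where t: "0 < v t" "v t < 1" using uniformizer by blast
  interpret fraction_packing "{poly P t | P. int_poly P}"
    "\<lambda>a b. \<exists>P Q. int_poly P \<and> int_poly Q \<and> a = poly P t \<and> b = poly Q t \<and> Q \<noteq> 0 \<and>
      (P = 0 \<or> degree P < degree Q)" "\<int>" "{poly P t | P. int_poly P}"
    using fin t by (rule fraction_packing_char_p)
  have "infinite {poly P t | P. int_poly P}"
  proof -
    have "int_poly (monom 1 n :: 'k poly)" "poly (monom 1 n) t = t ^ n" for n
      by (auto simp: int_poly_def poly_monom)
    hence "range (\<lambda>n. t ^ n) \<subseteq> {poly P t | P. int_poly P}"
      by (metis (mono_tags, lifting) image_subsetI mem_Collect_eq)
    moreover have "inj (\<lambda>n. t ^ n)"
    proof (rule injI)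
      fix m n assume "t ^ m = t ^ n"
      hence "v t ^ m = v t ^ n" by (metis v_power)
      thus "m = n" using t power_strict_decreasing_iff by (metis nat_neq_iff order_less_irrefl power_strict_decreasing)
    qed
    ultimately show ?thesis using range_inj_infinite infinite_super by blast
  qed
  show thesis
  proof (rule shear_packing_covering)
    fix W :: "('k \<times> 'k) set"
    assume W: "\<And>f g x y x' y'. \<lbrakk>f \<in> {poly P t | P. int_poly P}; g \<in> {poly P t | P. int_poly P};
        (x, y) \<in> W; (x', y') \<in> W; (x + f * y, y) = (x' + g * y', y')\<rbrakk> \<Longrightarrow> f = g"
      "\<And>x y. (x, y) \<noteq> (0, 0) \<Longrightarrow> (y, - x) \<in> W \<or> (\<exists>c\<in>\<int>. (x - c * y, y) \<in> W)"
    show thesis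
      by (rule that[of \<int> "{poly P t | P. int_poly P}" W, OF fin \<open>infinite _\<close> _ _ W])
        (use t in \<open>auto intro: v_Ints_le_1 v_int_poly_le_1\<close>)
  qed
qed

section \<open>Total boundedness from the finite residue field\<close>

text \<open>\<open>C\<close> consists of representatives of the finitely many residue classes;
  elements of one class differ by an element of valuation below 1.\<close>

lemma finite_cover_modulo_max_ideal:
  assumes "finite (carrier (residue_field v))"
  obtains C where "finite C" "\<And>x. v x \<le> 1 \<Longrightarrow> \<exists>c\<in>C. v (x - c) < 1"
proof -
  let ?cos = "\<lambda>x. max_ideal v +>\<^bsub>integers_ring v\<^esub> x"
  have cos: "?cos x = {h + x | h. v h < 1}" for x
    by (auto simp: a_r_coset_def r_coset_def max_ideal_def integers_ring_def)
  have "carrier (residue_field v) = ?cos ` {x. v x \<le> 1}"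
    by (auto simp: residue_field_def FactRing_def A_RCOSETS_def RCOSETS_def a_r_coset_def integers_ring_def)
  hence "finite (?cos ` {x. v x \<le> 1})" using assms by simp
  then obtain C where C: "C \<subseteq> {x. v x \<le> 1}" "finite C" "?cos ` {x. v x \<le> 1} = ?cos ` C"
    by (meson finite_subset_image subset_refl)
  have "\<exists>c\<in>C. v (x - c) < 1" if "v x \<le> 1" for x
  proof -
    have "?cos x \<in> ?cos ` C" using that unfolding C(3)[symmetric] by simp
    then obtain c where c: "c \<in> C" "?cos x = ?cos c" by (rule imageE)
    have "0 + x \<in> ?cos x" unfolding cos by (rule CollectI, rule exI[of _ 0]) simp
    hence "x \<in> {h + c | h. v h < 1}" unfolding c(2) cos[symmetric] by simp
    then obtain h where "x = h + c" "v h < 1" by blast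
    thus ?thesis using c(1) by (intro bexI[of _ c]) auto
  qed
  thus thesis by (rule that[OF C(2)])
qed

text \<open>Each step adds a digit to a t-adic expansion. Writing x - c = t^n y with y integral, a
  residue representative d of y leaves an error t^n (y - d). As \<open>v t\<close> is the largest
  valuation below 1, this gains a full factor of \<open>v t\<close>.\<close>

lemma finite_cover_power:
  assumes "finite (carrier (residue_field v))" "0 < v t" "\<And>x. v x < 1 \<Longrightarrow> v x \<le> v t"
  shows "\<exists>C. finite C \<and> (\<forall>x. v x \<le> 1 \<longrightarrow> (\<exists>c\<in>C. v (x - c) \<le> v t ^ n))"
proof (induction n)
  case 0
  show ?case by (rule exI[of _ "{0}"]) auto
next
  case (Suc n)
  then obtain C where C: "finite C" "\<And>x. v x \<le> 1 \<Longrightarrow> \<exists>c\<in>C. v (x - c) \<le> v t ^ n"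
    by blast
  obtain C0 where C0: "finite C0" "\<And>x. v x \<le> 1 \<Longrightarrow> \<exists>c\<in>C0. v (x - c) < 1"
    using finite_cover_modulo_max_ideal assms(1) by blast
  have t: "t \<noteq> 0" using assms(2) by auto
  let ?C = "(\<lambda>(c, d). c + t ^ n * d) ` (C \<times> C0)"
  have "\<exists>c\<in>?C. v (x - c) \<le> v t ^ Suc n" if "v x \<le> 1" for x
  proof -
    obtain c where c: "c \<in> C" "v (x - c) \<le> v t ^ n" using C(2) \<open>v x \<le> 1\<close> by blast
    define y where "y = (x - c) / t ^ n"
    have y: "x - c = t ^ n * y" using t by (simp add: y_def)
    have "v t ^ n * v y \<le> v t ^ n * 1" using c(2) by (simp add: y mult v_power)
    hence "v y \<le> 1" using assms(2) by (simp del: mult_1_right)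
    then obtain d where d: "d \<in> C0" "v (y - d) < 1" using C0(2) by blast
    have "x - (c + t ^ n * d) = t ^ n * (y - d)"
      using y by (simp add: algebra_simps)
    hence "v (x - (c + t ^ n * d)) = v t ^ n * v (y - d)" by (simp add: mult v_power)
    also have "\<dots> \<le> v t ^ n * v t"
      using assms(3)[OF d(2)] assms(2) by (intro mult_left_mono) auto
    finally have "v (x - (c + t ^ n * d)) \<le> v t ^ Suc n" by (simp add: mult.commute)
    thus ?thesis using c(1) d(1) by force
  qed
  moreover have "finite ?C" using C(1) C0(1) by simp
  ultimately show ?case by blast
qed

text \<open>Multiplication by t^k brings the ball of radius \<open>M\<close> into the ring of
  integers, where the cover of precision \<open>v t ^ n\<close> applies; dividing the centres by t^k
  scales it back.\<close>

lemma totally_bounded: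
  assumes "finite (carrier (residue_field v))" "\<epsilon> > 0"
  obtains C where "finite C" "\<And>x. v x \<le> M \<Longrightarrow> \<exists>c\<in>C. v (x - c) \<le> \<epsilon>"
proof -
  obtain t where t: "0 < v t" "v t < 1" "\<And>x. v x < 1 \<Longrightarrow> v x \<le> v t" using uniformizer by blast
  have t0: "t \<noteq> 0" using t(1) by auto
  \<comment> \<open>\<open>M\<close> may be zero or negative, but 1 / M' has to be positive.\<close>
  define M' where "M' = max M 1"
  have M': "M \<le> M'" "M' > 0" by (auto simp: M'_def)
  obtain k where k: "v t ^ k < 1 / M'" using real_arch_pow_inv[of "1 / M'" "v t"] t M' by auto
  obtain n where n: "v t ^ n < \<epsilon> * v t ^ k"
    using real_arch_pow_inv[of "\<epsilon> * v t ^ k" "v t"] t assms(2) by auto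
  obtain C where C: "finite C" "\<And>x. v x \<le> 1 \<Longrightarrow> \<exists>c\<in>C. v (x - c) \<le> v t ^ n"
    using finite_cover_power[OF assms(1) t(1,3), of n] by blast
  have "\<exists>c\<in>(\<lambda>c. c / t ^ k) ` C. v (x - c) \<le> \<epsilon>" if "v x \<le> M" for x
  proof -
    have "v (t ^ k * x) = v t ^ k * v x" by (simp add: mult v_power)
    also have "\<dots> \<le> (1 / M') * M'"
      using k M' that nonneg by (intro mult_mono) auto
    finally have "v (t ^ k * x) \<le> 1" using M' by simp
    then obtain c where c: "c \<in> C" "v (t ^ k * x - c) \<le> v t ^ n" using C(2) by blast
    have "t ^ k * x - c = t ^ k * (x - c / t ^ k)" using t0 by (simp add: field_simps)
    hence "v t ^ k * v (x - c / t ^ k) \<le> v t ^ n" using c(2) by (simp add: mult v_power)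
    also have "\<dots> \<le> v t ^ k * \<epsilon>" using n by (simp add: mult.commute)
    finally have "v (x - c / t ^ k) \<le> \<epsilon>" using t(1) by simp
    thus ?thesis using c(1) by blast
  qed
  thus thesis using that[of "(\<lambda>c. c / t ^ k) ` C"] C(1) by blast
qed

end

section \<open>Shears of K^n and the transfer to subsets of K^n\<close>

lemma finite_vec_set:
  assumes "finite C"
  shows "finite {x :: 'a ^ 'n. \<forall>i. x $ i \<in> C}"
proof -
  have "{x :: 'a ^ 'n. \<forall>i. x $ i \<in> C} \<subseteq> vec_lambda ` (UNIV \<rightarrow>\<^sub>E C)"
  proof
    fix x :: "'a ^ 'n" assume "x \<in> {x. \<forall>i. x $ i \<in> C}"
    moreover have "x = vec_lambda (\<lambda>i. x $ i)" by simp
    ultimately show "x \<in> vec_lambda ` (UNIV \<rightarrow>\<^sub>E C)" by blast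
  qed
  moreover have "finite (vec_lambda ` (UNIV \<rightarrow>\<^sub>E C) :: ('a ^ 'n) set)"
    using assms by (intro finite_imageI finite_PiE) auto
  ultimately show ?thesis by (rule finite_subset)
qed

definition shear :: "'n \<Rightarrow> 'n \<Rightarrow> 'k::field \<Rightarrow> 'k ^ 'n \<Rightarrow> 'k ^ 'n" where
  "shear i j f x = (\<chi> k. if k = i then x $ i + f * x $ j else x $ k)"

lemma shear_nth [simp]:
  "shear i j f x $ k = (if k = i then x $ i + f * x $ j else x $ k)"
  by (simp add: shear_def)

lemma shear_shear: "i \<noteq> j \<Longrightarrow> shear i j f (shear i j g x) = shear i j (f + g) x"
  by (auto simp: vec_eq_iff algebra_simps)

lemma shear_0 [simp]: "shear i j 0 x = x"
  by (auto simp: vec_eq_iff)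

context nonarch_valuation
begin

lemma SA_comp: "f \<in> carrier (SA v) \<Longrightarrow> g \<in> carrier (SA v) \<Longrightarrow> f \<circ> g \<in> carrier (SA v)"
  for f g :: "'k ^ 'n \<Rightarrow> 'k ^ 'n"
  using monoid.m_closed[OF group.is_monoid[OF SA_group]] by (fastforce simp: SA_def)

lemma SA_translation:
  fixes f :: "'k ^ 'n \<Rightarrow> 'k ^ 'n"
  assumes "f \<in> carrier (SA v)"
  shows "(\<lambda>x. f x + t) \<in> carrier (SA v)"
proof -
  obtain A u where "A \<in> SL v" "f = (\<lambda>x. A *v x + u)"
    using assms by (auto simp: SA_def)
  hence "A \<in> SL v" "(\<lambda>x. f x + t) = (\<lambda>x. A *v x + (u + t))"
    by (auto simp: add.assoc)
  thus ?thesis unfolding SA_def by auto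
qed

lemma SA_shear:
  fixes i j :: "'n::finite"
  assumes "i \<noteq> j" "v f \<le> 1"
  shows "shear i j f \<in> carrier (SA v)"
proof -
  define A :: "'k ^ 'n ^ 'n" where
    "A = (\<chi> k. if k = i then row i (mat 1) + f *s row j (mat 1) else row k (mat 1))"
  have "det A = 1"
    unfolding A_def using det_row_operation[OF assms(1), of "mat 1" f] by simp
  moreover have "v (A $ k $ l) \<le> 1" for k l
    using assms by (auto simp: A_def row_def mat_def)
  ultimately have "A \<in> SL v" by (simp add: SL_def integers_ring_def)
  moreover have "shear i j f = (\<lambda>x. A *v x + 0)"
  proof
    fix x :: "'k ^ 'n"
    have "A *v x = shear i j f (mat 1 *v x)"
      by (simp add: vec_eq_iff A_def matrix_vector_mult_def row_def distrib_right sum.distrib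
          sum_distrib_left mult.assoc)
    thus "shear i j f x = A *v x + 0" by simp
  qed
  ultimately show ?thesis unfolding SA_def by force
qed

text \<open>By the ultrametric inequality integral shears preserve every ball about 0, which keeps
  all copies of a piece inside one ball.\<close>

lemma shear_ball:
  assumes "v f \<le> 1" "\<And>k. v (x $ k) \<le> r"
  shows "v (shear i j f x $ k) \<le> r"
proof -
  have "v (f * x $ j) \<le> r"
    using mult_left_le_one_le[OF nonneg nonneg assms(1), of "x $ j"] assms(2)[of j]
    by (simp add: mult)
  thus ?thesis using assms by (auto intro: v_add_le)
qed

text \<open>The set to be copied is the part of the ball of radius r whose coordinates i and j form
  a point of \<open>W\<close>. Shears by elements of \<open>S\<close> move it to disjoint sets
  inside the ball, and translation by \<open>a\<close> brings these into \<open>P\<close>. Its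
  images under \<open>Q\<close> contain every vector of the ball with coordinates i, j not both
  zero, and finitely many translates of the ball cover \<open>P\<close>.\<close>

lemma paradoxical_if_shear_packing_covering:
  fixes P V :: "('k ^ 'n::finite) set" and i j :: 'n and W :: "('k \<times> 'k) set"
  assumes ij: "i \<noteq> j" and C: "finite C" "\<And>c. c \<in> C \<Longrightarrow> v c \<le> 1"
    and S: "infinite S" "\<And>f. f \<in> S \<Longrightarrow> v f \<le> 1"
    and pack: "\<And>f g x y x' y'. \<lbrakk>f \<in> S; g \<in> S; (x, y) \<in> W; (x', y') \<in> W;
      (x + f * y, y) = (x' + g * y', y')\<rbrakk> \<Longrightarrow> f = g"
    and cover: "\<And>x y. (x, y) \<noteq> (0, 0) \<Longrightarrow> (y, - x) \<in> W \<or> (\<exists>c\<in>C. (x - c * y, y) \<in> W)"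
    and d: "d \<noteq> 0" "v d \<le> r"
    and ball: "\<And>x. (\<And>k. v (x $ k) \<le> r) \<Longrightarrow> x + a \<in> P"
    and V: "finite V" "\<And>x. x \<in> P \<Longrightarrow> \<exists>w\<in>V. \<forall>k. v ((x - w) $ k) \<le> r"
  shows "paradoxical (SA v) UNIV (\<lambda>f. f) P"
proof -
  define B :: "('k ^ 'n) set" where "B = {x. (\<forall>k. v (x $ k) \<le> r) \<and> (x $ i, x $ j) \<in> W}"
  \<comment> \<open>In coordinates i and j this is (x, y) -> (-y, x), written as a product of three
    shears so that it visibly lies in \<open>SA v\<close>; \<open>rot'\<close> is the rotation
    occurring in \<open>cover\<close>.\<close>
  define rot :: "'k ^ 'n \<Rightarrow> 'k ^ 'n" where
    "rot = shear i j (- 1) \<circ> (shear j i 1 \<circ> shear i j (- 1))"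
  define rot' :: "'k ^ 'n \<Rightarrow> 'k ^ 'n" where
    "rot' = shear i j 1 \<circ> (shear j i (- 1) \<circ> shear i j 1)"
  define Q where "Q = insert rot (shear i j ` C)"
  define T where "T = (\<lambda>(h, w, e) x. h x + (w - e)) ` (Q \<times> V \<times> {0, axis i d})"
  have "rot \<in> carrier (SA v)"
    unfolding rot_def using ij by (intro SA_comp SA_shear) auto
  hence Q: "Q \<subseteq> carrier (SA v)"
    using SA_shear[OF ij] C(2) by (auto simp: Q_def)
  hence T: "T \<subseteq> carrier (SA v)"
    using SA_translation by (auto simp: T_def)
  have "finite T" using C(1) V(1) by (simp add: T_def Q_def)
  have rot': "rot (rot' x) = x" for x
    using ij by (simp add: rot_def rot'_def shear_shear)
  have reach: "\<exists>h\<in>Q. y \<in> h ` B" if y: "\<And>k. v (y $ k) \<le> r" "(y $ i, y $ j) \<noteq> (0, 0)" for y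
    using cover[OF y(2)]
  proof (elim disjE bexE)
    assume W: "(y $ j, - y $ i) \<in> W"
    have "v (rot' y $ k) \<le> r" for k
      unfolding rot'_def comp_def using y(1) by (intro shear_ball) auto
    moreover have "rot' y $ i = y $ j" "rot' y $ j = - y $ i"
      using ij by (auto simp: rot'_def)
    ultimately have "rot' y \<in> B" using W by (simp add: B_def)
    thus ?thesis using rot'[of y] by (intro bexI[of _ rot]) (auto simp: Q_def image_iff intro: sym)
  next
    fix c assume c: "c \<in> C" "(y $ i - c * y $ j, y $ j) \<in> W"
    have "shear i j (- c) y \<in> B"
      using shear_ball[of "- c" y r] C(2)[OF c(1)] y(1) c(2) ij by (simp add: B_def)
    moreover have "y = shear i j c (shear i j (- c) y)"
      using ij by (simp add: shear_shear)
    ultimately show ?thesis using c(1) by (auto simp: Q_def)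
  qed
  have "P \<subseteq> (\<Union>h\<in>T. h ` B)"
  proof
    fix x assume "x \<in> P"
    then obtain w where w: "w \<in> V" "\<And>k. v ((x - w) $ k) \<le> r" using V(2) by blast
    txt \<open>A vector whose coordinates \<open>i\<close>, \<open>j\<close> both vanish is first translated out of that subspace.\<close>
    define e where "e = (if ((x - w) $ i, (x - w) $ j) = (0, 0) then axis i d else 0)"
    have "0 \<le> r" using order_trans[OF nonneg d(2)] .
    hence "v (e $ k) \<le> r" for k using d(2) by (auto simp: e_def axis_def)
    hence "v ((x - w + e) $ k) \<le> r" for k
      using w(2)[of k] v_add_le[of "(x - w) $ k" r "e $ k"] by simp
    moreover have "((x - w + e) $ i, (x - w + e) $ j) \<noteq> (0, 0)"
      using ij d(1) by (auto simp: e_def axis_def)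
    ultimately obtain h b where h: "h \<in> Q" "b \<in> B" "x - w + e = h b"
      using reach by blast
    have "x = h b + (w - e)" using h(3) by (simp add: algebra_simps flip: h(3))
    moreover have "(\<lambda>x. h x + (w - e)) \<in> T"
      unfolding T_def using h w(1) by (intro image_eqI[of _ _ "(h, w, e)"]) (auto simp: e_def)
    ultimately show "x \<in> (\<Union>h\<in>T. h ` B)" using h(2) by blast
  qed
  moreover obtain g and m :: nat where g: "T = g ` {..<m}"
    using \<open>finite T\<close> by (metis finite_imp_nat_seg_image_inj_on lessThan_def)
  ultimately have cov: "P \<subseteq> (\<Union>k<m. g k ` B)" by simp
  obtain s :: "nat \<Rightarrow> 'k" where s: "inj s" "range s \<subseteq> S"
    using S(1) infinite_countable_subset by blast
  interpret group_action "SA v :: ('k ^ 'n \<Rightarrow> 'k ^ 'n) monoid" UNIV "\<lambda>f. f"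
    by (rule SA_group_action)
  show ?thesis
  proof (rule paradoxical_if_covered_by_packable[where t = "\<lambda>k x. shear i j (s k) x + a" and B = B
        and g = g and m = m])
    have "v ((0 :: 'k ^ 'n) $ k) \<le> r" for k
      using order_trans[OF nonneg d(2)] by simp
    thus "P \<noteq> {}" using ball[of 0] by blast
    show "(\<lambda>x. shear i j (s k) x + a) \<in> carrier (SA v)" for k
      using s(2) S(2) ij by (intro SA_translation SA_shear) auto
    show "(\<lambda>x. shear i j (s k) x + a) ` B \<subseteq> P" for k
    proof (intro image_subsetI ball shear_ball)
      show "v (s k) \<le> 1" using s(2) S(2) by auto
    qed (simp add: B_def)
    show "disjoint_family (\<lambda>k. (\<lambda>x. shear i j (s k) x + a) ` B)"
    proof (unfold disjoint_family_on_def, intro ballI impI)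
      fix m n :: nat assume "m \<noteq> n"
      hence mn: "s m \<noteq> s n" using s(1) by (auto dest: injD)
      have False if "x \<in> B" "y \<in> B" and eq: "shear i j (s m) x + a = shear i j (s n) y + a" for x y
      proof -
        have "shear i j (s m) x $ k = shear i j (s n) y $ k" for k using eq by simp
        from this[of i] this[of j]
        have "(x $ i + s m * x $ j, x $ j) = (y $ i + s n * y $ j, y $ j)"
          using ij by simp
        moreover have "s m \<in> S" "s n \<in> S" using s(2) by auto
        ultimately have "s m = s n"
          using that(1,2) by (intro pack[of "s m" "s n" "x $ i" "x $ j" "y $ i" "y $ j"]) (auto simp: B_def)
        thus False using mn by blast
      qed
      thus "(\<lambda>x. shear i j (s m) x + a) ` B \<inter> (\<lambda>x. shear i j (s n) x + a) ` B = {}"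
        by blast
    qed
    show "g k \<in> carrier (SA v)" if "k < m" for k using T g that by blast
  qed (use cov in auto)
qed

end

section \<open>Bounded sets with interior points: an inner ball and a finite cover\<close>

theorem corollary5p6:
  fixes v :: "'k::field \<Rightarrow> real"
    and E :: "('k ^ 'n::finite) set"
  assumes "discrete_valuation v"
    and "finite (carrier (residue_field v))"
    and "CARD('n) \<ge> 2"
    and "Metric_space.mbounded UNIV (max_dist v) E"
    and "Metric_space.mtopology UNIV (max_dist v) interior_of E \<noteq> {}"
  shows "paradoxical (SA v) UNIV (\<lambda>f. f) E"
proof -
  interpret discrete_valuation v by fact
  interpret Metric_space UNIV "max_dist v :: 'k ^ 'n \<Rightarrow> _" by (rule Metric_space_max_dist)
  obtain i j :: 'n where ij: "i \<noteq> j"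
    using assms(3) by (metis card_2_iff' card_le_Suc0_iff_eq finite_class.finite_UNIV UNIV_I
        numeral_2_eq_2 Suc_n_not_le_n order_trans)
  obtain a where "a \<in> mtopology interior_of E" using assms(5) by blast
  then obtain \<epsilon> where \<epsilon>: "\<epsilon> > 0" "mball a \<epsilon> \<subseteq> E"
    by (auto simp: interior_of_def openin_mtopology)
  \<comment> \<open>Halving passes from the open ball \<open>mball a \<epsilon>\<close> to a closed
    ball inside it.\<close>
  define r where "r = \<epsilon> / 2"
  have r: "r > 0" "r < \<epsilon>" using \<epsilon>(1) by (auto simp: r_def)
  have ball: "x + a \<in> E" if "\<And>k. v (x $ k) \<le> r" for x
  proof -
    have "max_dist v (x + a) a \<le> r"
      using that by (simp add: max_dist_def max_norm_le_iff)
    thus ?thesis using \<epsilon>(2) r(2) commute[of a "x + a"] by (auto simp: in_mball)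
  qed
  obtain d where d: "d \<noteq> 0" "v d \<le> r" using exists_small[OF r(1)] by blast
  obtain b M where bM: "E \<subseteq> mcball b M" using assms(4) by (auto simp: mbounded_def)
  obtain D where D: "finite D" "\<And>x. v x \<le> M \<Longrightarrow> \<exists>c\<in>D. v (x - c) \<le> r"
    using totally_bounded[OF assms(2) r(1)] by blast
  \<comment> \<open>For the maximum norm, approximating each coordinate of x - b by an element of
    \<open>D\<close> suffices, so a finite grid around the centre b does.\<close>
  define V where "V = (\<lambda>w. b + w) ` {w. \<forall>k. w $ k \<in> D}"
  have V: "\<exists>w\<in>V. \<forall>k. v ((x - w) $ k) \<le> r" if "x \<in> E" for x
  proof -
    have "max_dist v x b \<le> M" using bM that commute[of x b] by (auto simp: in_mcball)
    hence "\<exists>c\<in>D. v (x $ k - b $ k - c) \<le> r" for k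
      by (intro D(2)) (simp add: max_dist_def max_norm_le_iff)
    then obtain c where c: "\<And>k. c k \<in> D" "\<And>k. v (x $ k - b $ k - c k) \<le> r" by metis
    have "b + (\<chi> k. c k) \<in> V" using c(1) by (auto simp: V_def)
    moreover have "v ((x - (b + (\<chi> k. c k))) $ k) \<le> r" for k
      using c(2)[of k] by (simp add: diff_diff_eq)
    ultimately show ?thesis by blast
  qed
  have "finite V" unfolding V_def by (intro finite_imageI finite_vec_set D(1))
  show ?thesis
  proof (rule shear_packing_covering)
    fix C S :: "'k set" and W :: "('k \<times> 'k) set"
    assume "finite C" "infinite S" "\<And>c. c \<in> C \<Longrightarrow> v c \<le> 1" "\<And>f. f \<in> S \<Longrightarrow> v f \<le> 1"
      "\<And>f g x y x' y'. \<lbrakk>f \<in> S; g \<in> S; (x, y) \<in> W; (x', y') \<in> W;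
        (x + f * y, y) = (x' + g * y', y')\<rbrakk> \<Longrightarrow> f = g"
      "\<And>x y. (x, y) \<noteq> (0, 0) \<Longrightarrow> (y, - x) \<in> W \<or> (\<exists>c\<in>C. (x - c * y, y) \<in> W)"
    note W = this
    show ?thesis
    proof (rule paradoxical_if_shear_packing_covering
        [where W = W and r = r and a = a, OF ij W(1) _ W(2) _ _ _ d _ \<open>finite V\<close>])
      show "f = g" if "f \<in> S" "g \<in> S" "(x, y) \<in> W" "(x', y') \<in> W"
        "(x + f * y, y) = (x' + g * y', y')" for f g x y x' y'
        by (rule W(5)[OF that])
      show "x + a \<in> E" if "\<And>k. v (x $ k) \<le> r" for x
        by (rule ball[OF that])
    qed (rule W(3,4,6) V; assumption)+
  qed
qed

end
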